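(* Let $G=(V,w)$ be an $n$-vertex weighted graph and $A$ its adjacency matrix. There is a randomized algorithm that outputs a spanning forest of $G$ with probability at least $4/5$ after $O(\log(n)^4)$ many $[Av]_{>0}\circ(1-v)$ queries.
   Context: A weighted graph $G=(V,w)$ has a non-negative weight function $w$ on the 2-element subsets of $V$; its edges are the pairs of positive weight. Its adjacency matrix $A$ has $A(u,v)=w(\{u,v\})$ for $u\ne v$ and zero diagonal. A spanning forest of $G$ is a set of edges of $G$ forming a forest whose trees span exactly the connected components of $G$. For a real vector $y$, $[y]_{>0}$ is the Boolean vector whose $i$-th entry is $1$ iff $y_i>0$; $\circ$ is the entrywise product. In an $[Av]_{>0}\circ(1-v)$ query the algorithm submits any $v\in\{0,1\}^n$ and receives $[Av]_{>0}\circ(1-v)$. The algorithm accesses $G$ only through such queries. *)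

theory Defs
  imports
    "HOL-Probability.Probability_Mass_Function"
    "HOL-Library.Landau_Symbols"
    "Jordan_Normal_Form.Matrix"
begin

section \<open>Weighted graphs on the vertex set \<open>{..<n}\<close>\<close>

text \<open>Only the values of \<open>w\<close> on the two-element subsets of \<open>{..<n}\<close> matter.\<close>

definition weighted_graph :: "nat \<Rightarrow> (nat set \<Rightarrow> real) \<Rightarrow> bool" where
  "weighted_graph n w \<longleftrightarrow> (\<forall>e. e \<subseteq> {..<n} \<and> card e = 2 \<longrightarrow> 0 \<le> w e)"

definition edges :: "nat \<Rightarrow> (nat set \<Rightarrow> real) \<Rightarrow> nat set set" where
  "edges n w = {e. e \<subseteq> {..<n} \<and> card e = 2 \<and> 0 < w e}"

definition adjacency_mat :: "nat \<Rightarrow> (nat set \<Rightarrow> real) \<Rightarrow> real mat" where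
  "adjacency_mat n w = mat n n (\<lambda>(u, v). if u = v then 0 else w {u, v})"

section \<open>Spanning forests\<close>

text \<open>The forest notion of the AFP entry \<open>Graph_Theory\<close> concerns directed cycles: a symmetric
  digraph is never a forest there once it has an arc. Hence the undirected notions below.\<close>

definition is_cycle :: "'a set set \<Rightarrow> 'a list \<Rightarrow> bool" where
  "is_cycle F p \<longleftrightarrow> 3 \<le> length p \<and> distinct p \<and>
     (\<forall>i < length p. {p ! i, p ! (Suc i mod length p)} \<in> F)"

definition forest :: "'a set set \<Rightarrow> bool" where
  "forest F \<longleftrightarrow> (\<nexists>p. is_cycle F p)"

definition connected_components :: "'a set \<Rightarrow> 'a set set \<Rightarrow> 'a set set" where
  "connected_components V E =
     V // {(u, v). u \<in> V \<and> v \<in> V \<and> (u, v) \<in> {(x, y). {x, y} \<in> E}\<^sup>*}"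

text \<open>The vertex sets of the trees of \<open>F\<close>, isolated vertices included, are the components of
  \<open>({..<n}, F)\<close>.\<close>

definition spanning_forest :: "nat \<Rightarrow> (nat set \<Rightarrow> real) \<Rightarrow> nat set set \<Rightarrow> bool" where
  "spanning_forest n w F \<longleftrightarrow> F \<subseteq> edges n w \<and> forest F \<and>
     connected_components {..<n} F = connected_components {..<n} (edges n w)"

section \<open>Queries\<close>

definition boolean_vecs :: "nat \<Rightarrow> real vec set" where
  "boolean_vecs n = {v \<in> carrier_vec n. \<forall>i < n. v $ i \<in> {0, 1}}"

definition pos_indicator :: "real vec \<Rightarrow> real vec" where
  "pos_indicator y = map_vec (\<lambda>x. if 0 < x then 1 else 0) y"

definition query_answer :: "real mat \<Rightarrow> real vec \<Rightarrow> real vec" where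
  "query_answer A v = component_mult (pos_indicator (A *\<^sub>v v)) (map_vec (\<lambda>x. 1 - x) v)"

section \<open>Randomized adaptive query algorithms\<close>

text \<open>Queries are of type \<open>'q\<close>, answers of type \<open>'r\<close>, outputs of type \<open>'o\<close>. \<open>Query v f\<close> submits
  \<open>v\<close> and goes on as \<open>f r\<close> when the answer is \<open>r\<close>; \<open>Sample p\<close> goes on as an algorithm drawn
  from \<open>p\<close>. Only the number of queries is restricted, as usual for query complexity.\<close>

datatype ('q, 'r, 'o) query_alg =
    Output 'o
  | Query 'q "'r \<Rightarrow> ('q, 'r, 'o) query_alg"
  | Sample "('q, 'r, 'o) query_alg pmf"

text \<open>Joint distribution of the output and the list of submitted queries, when queries are
  answered by \<open>orc\<close>. The clause for \<open>Sample\<close> is \<open>bind_pmf p (run orc)\<close> in a form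
  that \<^bold>\<open>primrec\<close> accepts.\<close>

primrec run :: "('q \<Rightarrow> 'r) \<Rightarrow> ('q, 'r, 'o) query_alg \<Rightarrow> ('o \<times> 'q list) pmf" where
  "run orc (Output x) = return_pmf (x, [])"
| "run orc (Query v f) = map_pmf (\<lambda>(x, vs). (x, v # vs)) (run orc (f (orc v)))"
| "run orc (Sample p) = join_pmf (map_pmf (run orc) p)"

end

(* Boruvka contraction with random hooking. The vertices carry component labels. A trial colours the
   labels blue or red by a random bit position and a random bit value, and samples the blue vertices
   at a random density 2^-(j+2). The neighbour of a red vertex with exactly one sampled neighbour
   can be read off 2L queries, L = O(log n), one for each bit position and bit value of the vertex
   numbers; its label is then replaced by the label of that neighbour. A label with an edge leaving
   its component is hooked with probability at least 1/(16 L^2): some bit tells the two ends of the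
   edge apart, and for the right density exactly one blue neighbour is sampled with probability at
   least 1/8. So the expected number of unfinished labels shrinks by the factor 1 - 1/(16 L^2) in
   each trial, and 16 L^2 (L + 3) trials, that is O(L^4) queries, suffice. *)

theory Submission
  imports
    Defs
    "HOL-Probability.Product_PMF"
    "HOL-Library.Discrete_Functions"
begin

section \<open>Spanning forests of finite graphs\<close>

definition reachable :: "'a set set \<Rightarrow> ('a \<times> 'a) set" where
  "reachable F = {(x, y). {x, y} \<in> F}\<^sup>*"

lemma reachable_refl: "(x, x) \<in> reachable F"
  by (simp add: reachable_def)

lemma reachable_edge: "{x, y} \<in> F \<Longrightarrow> (x, y) \<in> reachable F"
  by (auto simp: reachable_def)

lemma reachable_trans: "(x, y) \<in> reachable F \<Longrightarrow> (y, z) \<in> reachable F \<Longrightarrow> (x, z) \<in> reachable F"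
  by (auto simp: reachable_def)

lemma reachable_sym: "(x, y) \<in> reachable F \<Longrightarrow> (y, x) \<in> reachable F"
proof -
  have "sym {(x, y). {x, y} \<in> F}" by (auto simp: sym_def insert_commute)
  then show "(x, y) \<in> reachable F \<Longrightarrow> (y, x) \<in> reachable F"
    unfolding reachable_def by (meson sym_rtrancl symE)
qed

lemma reachable_mono: "F \<subseteq> K \<Longrightarrow> reachable F \<subseteq> reachable K"
  unfolding reachable_def by (rule rtrancl_mono) auto

text \<open>The rest of the cycle still joins the two ends of its closing edge, so dropping that
  edge changes no component.\<close>

lemma reachable_remove_cycle_edge:
  assumes p: "is_cycle F p"
  defines "e \<equiv> {p ! (length p - 1), p ! 0}"
  shows "e \<in> F" "reachable (F - {e}) = reachable F"
proof -
  define m where "m = length p - 1"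
  have len: "length p = Suc m" "2 \<le> m" and dist: "distinct p"
    using p by (auto simp: is_cycle_def m_def)
  have edge: "{p ! i, p ! (Suc i mod length p)} \<in> F" if "i < length p" for i
    using p that by (auto simp: is_cycle_def)
  show "e \<in> F" using edge[of m] len by (simp add: e_def)
  have e: "e = {p ! m, p ! 0}" by (simp add: e_def m_def)
  have path: "(p ! 0, p ! i) \<in> reachable (F - {e})" if "i \<le> m" for i
    using that
  proof (induction i)
    case 0
    show ?case by (rule reachable_refl)
  next
    case (Suc i)
    have "{p ! i, p ! Suc i} \<in> F" using edge[of i] Suc.prems len by simp
    \<comment> \<open>Equality would force \<open>i = 0\<close> and \<open>Suc i = m\<close>, hence
      \<open>m = 1\<close>; but a cycle has length at least 3.\<close>
    moreover have "{p ! i, p ! Suc i} \<noteq> e"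
      using Suc.prems len dist by (auto simp: e doubleton_eq_iff nth_eq_iff_index_eq)
    ultimately show ?case
      using Suc by (auto intro: reachable_trans reachable_edge)
  qed
  have e_reach: "(x, y) \<in> reachable (F - {e})" if "{x, y} = e" for x y
    using path[of m] reachable_sym[OF path[of m]] that by (auto simp: e doubleton_eq_iff)
  have "{(x, y). {x, y} \<in> F} \<subseteq> reachable (F - {e})"
    using e_reach by (auto intro: reachable_edge)
  then have "reachable F \<subseteq> reachable (F - {e})"
    unfolding reachable_def by (metis rtrancl_idemp rtrancl_mono)
  then show "reachable (F - {e}) = reachable F"
    using reachable_mono[of "F - {e}" F] by auto
qed

text \<open>As long as there is a cycle, its closing edge can be deleted without changing
  reachability; finiteness ends the process.\<close>

lemma spanning_forest_exists:
  assumes "finite K"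
  shows "\<exists>F. F \<subseteq> K \<and> forest F \<and> reachable F = reachable K"
  using assms
proof (induction K rule: finite_psubset_induct)
  case (psubset K)
  show ?case
  proof (cases "forest K")
    case False
    then obtain p where p: "is_cycle K p" by (auto simp: forest_def)
    let ?e = "{p ! (length p - 1), p ! 0}"
    obtain F where "F \<subseteq> K - {?e}" "forest F" "reachable F = reachable (K - {?e})"
      using psubset.IH[of "K - {?e}"] reachable_remove_cycle_edge(1)[OF p] by blast
    then show ?thesis
      using reachable_remove_cycle_edge(2)[OF p] by blast
  qed auto
qed

definition some_forest :: "'a set set \<Rightarrow> 'a set set" where
  "some_forest K = (SOME F. F \<subseteq> K \<and> forest F \<and> reachable F = reachable K)"

lemma some_forest:
  assumes "finite K"
  shows "some_forest K \<subseteq> K" "forest (some_forest K)" "reachable (some_forest K) = reachable K"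
  using someI_ex[OF spanning_forest_exists[OF assms]] by (auto simp: some_forest_def)

lemma finite_edges: "finite (edges n w)"
  by (rule finite_subset[of _ "Pow {..<n}"]) (auto simp: edges_def)

lemma edges_lessD: "{x, y} \<in> edges n w \<Longrightarrow> x < n \<and> y < n \<and> x \<noteq> y"
  by (auto simp: edges_def)

lemma connected_components_cong:
  assumes "\<And>u v. u \<in> V \<Longrightarrow> v \<in> V \<Longrightarrow> (u, v) \<in> reachable F \<longleftrightarrow> (u, v) \<in> reachable E"
  shows "connected_components V F = connected_components V E"
proof -
  have "{(u, v). u \<in> V \<and> v \<in> V \<and> (u, v) \<in> reachable F} =
      {(u, v). u \<in> V \<and> v \<in> V \<and> (u, v) \<in> reachable E}"
    using assms by auto
  then show ?thesis by (simp add: connected_components_def reachable_def)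
qed

section \<open>Component labellings\<close>

text \<open>Loop invariant. Equal labels certify a connection by edges found so far; the converse
  may fail, since all found edges are kept while \<open>relabel\<close> follows only one per
  label.\<close>

definition labelled_partition ::
    "nat \<Rightarrow> nat set set \<Rightarrow> nat set set \<Rightarrow> (nat \<Rightarrow> nat) \<Rightarrow> bool" where
  "labelled_partition n E K l \<longleftrightarrow> K \<subseteq> E \<and> (\<forall>x < n. l x < n) \<and>
     (\<forall>x < n. \<forall>y < n. l x = l y \<longrightarrow> (x, y) \<in> reachable K)"

text \<open>Potential of the analysis: the output is correct once this set is empty, and its
  expected size shrinks with every trial.\<close>

definition unfinished :: "nat set set \<Rightarrow> (nat \<Rightarrow> nat) \<Rightarrow> nat set" where
  "unfinished E l = {l x | x y. {x, y} \<in> E \<and> l x \<noteq> l y}"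

lemma unfinished_subset:
  assumes "labelled_partition n (edges n w) K l"
  shows "unfinished (edges n w) l \<subseteq> {..<n}"
  using assms by (auto simp: unfinished_def labelled_partition_def dest: edges_lessD)

text \<open>Without unfinished labels every edge joins equal labels, so labels are constant on the
  components of the graph, and the invariant connects each component within
  \<open>K\<close>.\<close>

lemma spanning_forest_some_forest:
  assumes inv: "labelled_partition n (edges n w) K l"
    and fin: "unfinished (edges n w) l = {}"
  shows "spanning_forest n w (some_forest K)"
proof -
  have K: "K \<subseteq> edges n w" using inv by (simp add: labelled_partition_def)
  have finK: "finite K" using K finite_edges by (rule finite_subset)
  have same: "l x = l y" if "(x, y) \<in> reachable (edges n w)" for x y
    using that unfolding reachable_def
    by (induction rule: rtrancl_induct) (use fin in \<open>auto simp: unfinished_def\<close>)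
  have "(u, v) \<in> reachable (some_forest K) \<longleftrightarrow> (u, v) \<in> reachable (edges n w)"
    if "u \<in> {..<n}" "v \<in> {..<n}" for u v
    using that same[of u v] inv reachable_mono[OF K] some_forest(3)[OF finK]
    by (auto simp: labelled_partition_def)
  then have "connected_components {..<n} (some_forest K) = connected_components {..<n} (edges n w)"
    by (rule connected_components_cong)
  then show ?thesis
    using some_forest[OF finK] K by (auto simp: spanning_forest_def)
qed

text \<open>In \<open>relabel l D\<close> the pairs in \<open>D\<close> point from red to blue vertices; every red label that
  occurs is replaced by the blue label at the other end of one such pair.\<close>

definition relabel :: "(nat \<Rightarrow> nat) \<Rightarrow> (nat \<times> nat) set \<Rightarrow> nat \<Rightarrow> nat" where
  "relabel l D x = (if \<exists>v u. (v, u) \<in> D \<and> l v = l x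
     then l (SOME u. \<exists>v. (v, u) \<in> D \<and> l v = l x) else l x)"

lemma relabel_cases:
  obtains (hooked) v u where "(v, u) \<in> D" "l v = l x" "relabel l D x = l u"
    | (unhooked) "\<And>v u. (v, u) \<in> D \<Longrightarrow> l v \<noteq> l x" "relabel l D x = l x"
proof (cases "\<exists>v u. (v, u) \<in> D \<and> l v = l x")
  case True
  then have "\<exists>u v. (v, u) \<in> D \<and> l v = l x" by blast
  from someI_ex[OF this] True that(1) show ?thesis by (auto simp: relabel_def)
next
  case False
  then have "relabel l D x = l x" unfolding relabel_def by (rule if_not_P)
  then show ?thesis using that(2) False by blast
qed

lemma relabel_cong: "l x = l y \<Longrightarrow> relabel l D x = relabel l D y"
  by (simp only: relabel_def)

text \<open>The enlarged edge set joins each vertex to one whose old label is its new label; the old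
  invariant then links vertices of equal new label through these representatives.\<close>

lemma labelled_partition_relabel:
  assumes inv: "labelled_partition n (edges n w) K l"
    and D: "\<And>v u. (v, u) \<in> D \<Longrightarrow> {v, u} \<in> edges n w"
  shows "labelled_partition n (edges n w) (K \<union> (\<lambda>(v, u). {v, u}) ` D) (relabel l D)"
proof -
  let ?K = "K \<union> (\<lambda>(v, u). {v, u}) ` D"
  have conn: "(x, y) \<in> reachable ?K" if "x < n" "y < n" "l x = l y" for x y
    using inv that reachable_mono[of K ?K] by (auto simp: labelled_partition_def)
  have rep: "\<exists>y < n. (x, y) \<in> reachable ?K \<and> l y = relabel l D x" if x: "x < n" for x
  proof (cases rule: relabel_cases[of D l x])
    case (hooked v u)
    then have vu: "v < n" "u < n" using D edges_lessD by blast+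
    have "(v, u) \<in> reachable ?K" using hooked(1) by (intro reachable_edge) force
    then have "(x, u) \<in> reachable ?K" using conn[OF x vu(1)] hooked(2) reachable_trans by metis
    then show ?thesis using vu hooked(3) by auto
  next
    case unhooked
    then show ?thesis using x by (auto intro: reachable_refl)
  qed
  have "(x, y) \<in> reachable ?K" if xy: "x < n" "y < n" "relabel l D x = relabel l D y" for x y
  proof -
    obtain x' where x': "x' < n" "(x, x') \<in> reachable ?K" "l x' = relabel l D x"
      using rep[OF xy(1)] by blast
    obtain y' where y': "y' < n" "(y, y') \<in> reachable ?K" "l y' = relabel l D y"
      using rep[OF xy(2)] by blast
    have "(x', y') \<in> reachable ?K" using conn[OF x'(1) y'(1)] x'(3) y'(3) xy(3) by simp
    then show ?thesis by (rule reachable_trans[OF reachable_trans[OF x'(2)] reachable_sym[OF y'(2)]])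
  qed
  moreover have "relabel l D x < n" if "x < n" for x
    using rep[OF that] inv by (auto simp: labelled_partition_def)
  ultimately show ?thesis
    using inv D by (auto simp: labelled_partition_def)
qed

text \<open>A hook always leads from a red label to a blue one. Hence hooked labels vanish, and a label
  that is unfinished afterwards was unfinished before.\<close>

lemma unfinished_relabel:
  assumes D: "\<And>v u. (v, u) \<in> D \<Longrightarrow> {v, u} \<in> E \<and> \<not> blue (l v) \<and> blue (l u)"
  shows "unfinished E (relabel l D) \<subseteq> unfinished E l - (l \<circ> fst) ` D"
proof
  fix a assume "a \<in> unfinished E (relabel l D)"
  then obtain x y where xy: "{x, y} \<in> E" "a = relabel l D x" "relabel l D x \<noteq> relabel l D y"
    by (auto simp: unfinished_def)
  show "a \<in> unfinished E l - (l \<circ> fst) ` D"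
  proof (cases rule: relabel_cases[of D l x])
    case (hooked v u)
    \<comment> \<open>The hooking edge itself shows that the surviving blue label was unfinished
      before.\<close>
    have "{u, v} \<in> E" "l u \<noteq> l v" "blue a"
      using D[OF hooked(1)] hooked(3) xy(2) by (auto simp: insert_commute)
    then have "a \<in> unfinished E l" using hooked(3) xy(2) unfolding unfinished_def by blast
    moreover have "a \<notin> (l \<circ> fst) ` D" using \<open>blue a\<close> D by force
    ultimately show ?thesis by blast
  next
    case unhooked
    have "l x \<noteq> l y" using xy(3) relabel_cong by metis
    then have "a \<in> unfinished E l" using unhooked xy unfolding unfinished_def by auto
    moreover have "a \<notin> (l \<circ> fst) ` D" using unhooked xy(2) by force
    ultimately show ?thesis by blast
  qed
qed

section \<open>Decoding query answers\<close>

definition set_vec :: "nat \<Rightarrow> nat set \<Rightarrow> real vec" where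
  "set_vec n S = vec n (\<lambda>i. if i \<in> S then 1 else 0)"

lemma set_vec_in_boolean_vecs: "set_vec n S \<in> boolean_vecs n"
  by (auto simp: set_vec_def boolean_vecs_def)

text \<open>Weights are non-negative, so nothing cancels: the sum over \<open>S\<close> is positive
  iff one of its terms is. The factor 1 - v blanks the entries inside \<open>S\<close>.\<close>

lemma query_answer_set_vec:
  assumes w: "weighted_graph n w" and v: "v < n" and S: "S \<subseteq> {..<n}"
  shows "query_answer (adjacency_mat n w) (set_vec n S) $ v =
    (if v \<notin> S \<and> (\<exists>u \<in> S. {v, u} \<in> edges n w) then 1 else 0)"
proof -
  let ?A = "adjacency_mat n w"
  let ?f = "\<lambda>u. (if v = u then 0 else w {v, u}) * (if u \<in> S then 1 else 0)"
  have nonneg: "0 \<le> ?f u" if "u \<in> {..<n}" for u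
    using w v that by (auto simp: weighted_graph_def card_insert_if)
  have "(?A *\<^sub>v set_vec n S) $ v = (\<Sum>u<n. ?f u)"
    using v by (simp add: adjacency_mat_def set_vec_def scalar_prod_def atLeast0LessThan)
  moreover have "0 < (\<Sum>u<n. ?f u) \<longleftrightarrow> (\<exists>u \<in> S. {v, u} \<in> edges n w)"
  proof -
    have "0 < (\<Sum>u<n. ?f u) \<longleftrightarrow> (\<Sum>u<n. ?f u) \<noteq> 0"
      using sum_nonneg[of "{..<n}" ?f] nonneg by force
    also have "\<dots> \<longleftrightarrow> (\<exists>u<n. ?f u \<noteq> 0)"
      using sum_nonneg_eq_0_iff[of "{..<n}" ?f] nonneg by auto
    also have "\<dots> \<longleftrightarrow> (\<exists>u<n. 0 < ?f u)"
      using nonneg by (metis (no_types, lifting) lessThan_iff less_le)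
    also have "\<dots> \<longleftrightarrow> (\<exists>u \<in> S. {v, u} \<in> edges n w)"
      using S v by (auto simp: edges_def card_insert_if split: if_splits)
    finally show ?thesis .
  qed
  moreover have "dim_row ?A = n" by (simp add: adjacency_mat_def)
  ultimately show ?thesis
    using v by (simp add: query_answer_def component_mult_def pos_indicator_def set_vec_def)
qed

text \<open>A choice \<open>((b, c), R)\<close> colours the labels with \<open>b\<close>-th bit \<open>c\<close> blue; the sampled vertices
  are those with a blue label in the random set \<open>R\<close>. The query with key \<open>(i, d)\<close> submits the
  sampled vertices with \<open>i\<close>-th bit \<open>d\<close>. A red vertex has exactly one sampled neighbour iff these
  answers spell out the binary digits of a number, which is then that neighbour.\<close>

type_synonym trial_choice = "(nat \<times> bool) \<times> (nat \<Rightarrow> bool)"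

definition sampled :: "nat \<Rightarrow> (nat \<Rightarrow> nat) \<Rightarrow> trial_choice \<Rightarrow> nat set" where
  "sampled n l = (\<lambda>((b, c), R). {x. x < n \<and> bit (l x) b = c \<and> R x})"

definition trial_query ::
    "nat \<Rightarrow> (nat \<Rightarrow> nat) \<Rightarrow> trial_choice \<Rightarrow> nat \<times> bool \<Rightarrow> real vec" where
  "trial_query n l ch = (\<lambda>(i, d). set_vec n {x \<in> sampled n l ch. bit x i = d})"

definition decode ::
    "nat \<Rightarrow> nat \<Rightarrow> (nat \<Rightarrow> nat) \<Rightarrow> trial_choice \<Rightarrow> (nat \<times> bool \<Rightarrow> real vec) \<Rightarrow> (nat \<times> nat) set" where
  "decode L n l = (\<lambda>((b, c), R) ans. {(v, u). v < n \<and> u < n \<and> bit (l v) b \<noteq> c \<and>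
     (\<forall>i < L. ans (i, bit u i) $ v = 1 \<and> ans (i, \<not> bit u i) $ v = 0)})"

lemma bit_lessD:
  fixes x :: nat
  assumes "x < 2 ^ L" "bit x i"
  shows "i < L"
  using assms by (metis bit_take_bit_iff take_bit_nat_eq_self_iff)

lemma nat_bit_eqI:
  fixes x y :: nat
  assumes "x < 2 ^ L" "y < 2 ^ L" "\<And>i. i < L \<Longrightarrow> bit x i = bit y i"
  shows "x = y"
  using assms bit_lessD by (intro bit_eqI) blast

text \<open>A second sampled neighbour would differ from \<open>u\<close> in some bit
  \<open>i < L\<close> and turn the answer for the opposite value of that bit into 1.\<close>

lemma decode_trial_query:
  assumes w: "weighted_graph n w" and L: "0 < L" "n \<le> 2 ^ L"
    and ans: "\<And>k. k \<in> {..<L} \<times> UNIV \<Longrightarrow>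
      ans k = query_answer (adjacency_mat n w) (trial_query n l ((b, c), R) k)"
  shows "decode L n l ((b, c), R) ans = {(v, u). v < n \<and> bit (l v) b \<noteq> c \<and>
    {x \<in> sampled n l ((b, c), R). {v, x} \<in> edges n w} = {u}}"
proof -
  let ?S = "sampled n l ((b, c), R)"
  have S: "?S \<subseteq> {..<n}" by (auto simp: sampled_def)
  have answer: "ans (i, d) $ v = (if \<exists>u \<in> ?S. bit u i = d \<and> {v, u} \<in> edges n w then 1 else 0)"
    if "v < n" "bit (l v) b \<noteq> c" "i < L" for i d v
  proof -
    \<comment> \<open>Sampled vertices are blue, so the mask never hides the answer at a red
      vertex.\<close>
    have "v \<notin> ?S" using that by (simp add: sampled_def)
    then show ?thesis
      using that S by (subst ans)
        (auto simp: trial_query_def query_answer_set_vec[OF w] subset_iff)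
  qed
  have "(u < n \<and> (\<forall>i < L. ans (i, bit u i) $ v = 1 \<and> ans (i, \<not> bit u i) $ v = 0)) \<longleftrightarrow>
      {x \<in> ?S. {v, x} \<in> edges n w} = {u}" (is "?l \<longleftrightarrow> ?N = _")
    if v: "v < n" "bit (l v) b \<noteq> c" for u v
  proof
    assume l: ?l
    \<comment> \<open>Bit position 0 is queried since \<open>0 < L\<close>; its answer 1 rules out
      that no neighbour is sampled.\<close>
    have "ans (0, bit u 0) $ v = 1" using l L(1) by blast
    then have "?N \<noteq> {}" unfolding answer[OF v L(1)] by (auto split: if_splits)
    moreover have "x = u" if x: "x \<in> ?N" for x
    proof (rule nat_bit_eqI)
      show "x < 2 ^ L" "u < 2 ^ L" using x S l L by auto
      fix i assume i: "i < L"
      show "bit x i = bit u i"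
        using l i x answer[OF v i, of "\<not> bit u i"] by (auto split: if_splits)
    qed
    ultimately show "?N = {u}" by blast
  next
    assume N: "?N = {u}"
    have uniq: "x = u" if "x \<in> ?S" "{v, x} \<in> edges n w" for x using that N by blast
    have u: "u \<in> ?S" "{v, u} \<in> edges n w" "u < n" using N S by auto
    have "ans (i, bit u i) $ v = 1" if "i < L" for i
      unfolding answer[OF v that] using u by auto
    moreover have "ans (i, \<not> bit u i) $ v = 0" if "i < L" for i
      unfolding answer[OF v that] using uniq by auto
    ultimately show ?l using u(3) by blast
  qed
  then show ?thesis
    by (simp only: decode_def prod.case set_eq_iff[of "{(v, u). _ v u}"] mem_Collect_eq split_paired_All) blast
qed

section \<open>The probability of a hook\<close>

text \<open>For a set of at least \<open>2 ^ j\<close> and fewer than \<open>2 ^ (j + 1)\<close>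
  vertices, the expected number sampled at this density lies between 1/4 and 1/2.\<close>

definition sampling :: "nat \<Rightarrow> nat \<Rightarrow> (nat \<Rightarrow> bool) pmf" where
  "sampling n j = Pi_pmf {..<n} False (\<lambda>_. bernoulli_pmf (1 / 2 ^ (j + 2)))"

lemma prob_sampling_singleton:
  assumes M: "M \<subseteq> {..<n}" and u: "u \<in> M"
  shows "measure_pmf.prob (sampling n j) {R. {x \<in> M. R x} = {u}} =
    1 / 2 ^ (j + 2) * (1 - 1 / 2 ^ (j + 2)) ^ (card M - 1)"
proof -
  let ?p = "1 / 2 ^ (j + 2) :: real"
  let ?B = "\<lambda>x. if x = u then {True} else if x \<in> M then {False} else UNIV"
  have p: "0 \<le> ?p" "?p \<le> 1"
    using one_le_power[of "2 :: real" "j + 2"] by (auto simp: divide_le_eq_1)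
  have finM: "finite M" using M finite_subset by blast
  \<comment> \<open>A box event: one prescribed outcome at each vertex of \<open>M\<close>, none
    elsewhere. Independence makes its probability a product.\<close>
  have "{R. {x \<in> M. R x} = {u}} = Pi {..<n} ?B"
    using M u by (auto simp: Pi_iff subset_iff split: if_splits)
  then have "measure_pmf.prob (sampling n j) {R. {x \<in> M. R x} = {u}} =
      (\<Prod>x<n. measure_pmf.prob (bernoulli_pmf ?p) (?B x))"
    by (simp only: sampling_def measure_Pi_pmf_Pi finite_lessThan)
  also have "\<dots> = (\<Prod>x<n. if x \<in> M then (if x = u then ?p else 1 - ?p) else 1)"
    using p u by (intro prod.cong) (auto simp: measure_pmf_single)
  also have "\<dots> = (\<Prod>x\<in>M. if x = u then ?p else 1 - ?p)"
    using M by (subst prod.inter_restrict[symmetric]) (auto intro!: prod.cong)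
  also have "\<dots> = ?p * (\<Prod>x\<in>M - {u}. 1 - ?p)"
    using finM u by (subst prod.remove[of M u]) (auto intro!: prod.cong)
  also have "\<dots> = ?p * (1 - ?p) ^ (card M - 1)"
    using u finM by (simp add: card_Diff_singleton)
  finally show ?thesis .
qed

text \<open>The events for different \<open>u\<close> are disjoint and sum to |M| p (1 - p)^(|M| -
  1). Here |M| p is at least 1/4, and Bernoulli's inequality with (|M| - 1) p \<le> 1/2 bounds the
  power below by 1/2.\<close>

lemma prob_sampling_unique:
  assumes M: "M \<subseteq> {..<n}" "M \<noteq> {}"
  shows "1 / 8 \<le> measure_pmf.prob (sampling n (floor_log (card M))) {R. \<exists>u. {x \<in> M. R x} = {u}}"
proof -
  let ?j = "floor_log (card M)"
  define p :: real where "p = 1 / 2 ^ (?j + 2)"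
  have finM: "finite M" using M finite_subset by blast
  then have m: "0 < card M" using M by auto
  have p: "0 \<le> p" "p \<le> 1"
    using one_le_power[of "2 :: real" "?j + 2"] by (auto simp: p_def divide_le_eq_1)
  have "2 ^ ?j \<le> real (card M)" using of_nat_mono[OF floor_log_exp2_le[OF m], where ?'a = real] by simp
  then have low: "1 / 4 \<le> real (card M) * p" by (simp add: p_def field_simps)
  have "real (card M) < real (2 * 2 ^ ?j)" by (simp only: of_nat_less_iff floor_log_exp2_gt)
  then have "real (card M - 1) * p \<le> 1 / 2" using m by (simp add: p_def field_simps of_nat_diff)
  moreover have "1 + real (card M - 1) * (- p) \<le> (1 + - p) ^ (card M - 1)"
    using p by (intro Bernoulli_inequality) auto
  ultimately have high: "1 / 2 \<le> (1 - p) ^ (card M - 1)" by simp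
  have "1 / 8 \<le> (real (card M) * p) * (1 - p) ^ (card M - 1)"
    using mult_mono[OF low high] p by simp
  also have "\<dots> = (\<Sum>u\<in>M. measure_pmf.prob (sampling n ?j) {R. {x \<in> M. R x} = {u}})"
    using M by (simp add: prob_sampling_singleton p_def)
  also have "\<dots> = measure_pmf.prob (sampling n ?j) (\<Union>u\<in>M. {R. {x \<in> M. R x} = {u}})"
    using finM by (intro measure_pmf.finite_measure_finite_Union[symmetric])
      (auto simp: disjoint_family_on_def)
  also have "\<dots> \<le> measure_pmf.prob (sampling n ?j) {R. \<exists>u. {x \<in> M. R x} = {u}}"
    by (intro measure_pmf.finite_measure_mono) auto
  finally show ?thesis .
qed

section \<open>The random choices of one trial\<close>

definition trial_choices :: "nat \<Rightarrow> nat \<Rightarrow> trial_choice pmf" where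
  "trial_choices L n = bind_pmf (pmf_of_set (({..<L} \<times> UNIV) \<times> {..<L}))
     (\<lambda>(bc, j). map_pmf (Pair bc) (sampling n j))"

lemma prob_bind_pmf:
  "measure_pmf.prob (bind_pmf p f) A = measure_pmf.expectation p (\<lambda>x. measure_pmf.prob (f x) A)"
proof -
  have "integrable (measure_pmf p) (\<lambda>x. measure_pmf.prob (f x) A)"
    by (intro measure_pmf.integrable_const_bound[of _ 1]) auto
  then have "ennreal (measure_pmf.prob (bind_pmf p f) A) =
      ennreal (measure_pmf.expectation p (\<lambda>x. measure_pmf.prob (f x) A))"
    by (subst nn_integral_eq_integral[symmetric])
      (auto simp: emeasure_bind_pmf measure_pmf.emeasure_eq_measure[symmetric])
  then show ?thesis by (simp add: integral_nonneg_AE)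
qed

text \<open>Condition on one of the \<open>2 * L ^ 2\<close> equally likely triples of bit position,
  bit value and density.\<close>

lemma prob_trial_choices_ge:
  assumes "b < L" "j < L"
  shows "measure_pmf.prob (sampling n j) {R. ((b, c), R) \<in> A} / (2 * real L ^ 2)
    \<le> measure_pmf.prob (trial_choices L n) A"
proof -
  let ?I = "({..<L} \<times> (UNIV :: bool set)) \<times> {..<L}"
  let ?g = "\<lambda>(bc, j). measure_pmf.prob (sampling n j) {R. (bc, R) \<in> A}"
  have I: "finite ?I" "?I \<noteq> {}" "((b, c), j) \<in> ?I" using assms by auto
  have "?g ((b, c), j) \<le> sum ?g ?I"
    using I by (intro member_le_sum) auto
  then have "?g ((b, c), j) / card ?I \<le> sum ?g ?I / card ?I"
    by (rule divide_right_mono) simp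
  also have "\<dots> = measure_pmf.prob (trial_choices L n) A"
    unfolding trial_choices_def prob_bind_pmf integral_pmf_of_set[OF I(2,1)]
    by (intro arg_cong2[where f = "(/)"] sum.cong) (auto simp: vimage_def)
  finally show ?thesis by (simp add: power2_eq_square card_cartesian_product mult_ac)
qed

section \<open>The algorithm\<close>

fun ask_all :: "'k list \<Rightarrow> ('k \<Rightarrow> 'q) \<Rightarrow> (('k \<Rightarrow> 'r) \<Rightarrow> ('q, 'r, 'o) query_alg) \<Rightarrow> ('q, 'r, 'o) query_alg"
  where
  "ask_all [] q f = f (\<lambda>_. undefined)"
| "ask_all (k # ks) q f = Query (q k) (\<lambda>r. ask_all ks q (\<lambda>ans. f (ans(k := r))))"

lemma run_ask_all:
  "\<exists>ans. (\<forall>k \<in> set ks. ans k = orc (q k)) \<and>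
     run orc (ask_all ks q f) = map_pmf (\<lambda>(x, vs). (x, map q ks @ vs)) (run orc (f ans))"
proof (induction ks arbitrary: f)
  case Nil
  show ?case by (auto simp: case_prod_unfold map_pmf_ident)
next
  case (Cons k ks)
  obtain ans where ans: "\<forall>k \<in> set ks. ans k = orc (q k)"
    "run orc (ask_all ks q (\<lambda>ans. f (ans(k := orc (q k))))) =
      map_pmf (\<lambda>(x, vs). (x, map q ks @ vs)) (run orc (f (ans(k := orc (q k)))))"
    using Cons.IH by meson
  show ?case
  proof (intro exI conjI)
    show "\<forall>k' \<in> set (k # ks). (ans(k := orc (q k))) k' = orc (q k')"
      using ans(1) by simp
    show "run orc (ask_all (k # ks) q f) =
        map_pmf (\<lambda>(x, vs). (x, map q (k # ks) @ vs)) (run orc (f (ans(k := orc (q k)))))"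
      by (simp only: ask_all.simps run.simps ans(2) pmf.map_comp)
        (simp add: comp_def case_prod_unfold)
  qed
qed

definition trial_keys :: "nat \<Rightarrow> (nat \<times> bool) list" where
  "trial_keys L = List.product [0..<L] [False, True]"

lemma trial_keys: "set (trial_keys L) = {..<L} \<times> UNIV" "length (trial_keys L) = 2 * L"
  by (auto simp: trial_keys_def UNIV_bool)

text \<open>All found edges are kept in \<open>K\<close>, possibly with cycles; a forest is
  extracted only at the end, which costs no query.\<close>

primrec forest_alg ::
    "nat \<Rightarrow> nat \<Rightarrow> nat \<Rightarrow> nat set set \<Rightarrow> (nat \<Rightarrow> nat) \<Rightarrow> (real vec, real vec, nat set set) query_alg"
  where
  "forest_alg L n 0 K l = Output (some_forest K)"
| "forest_alg L n (Suc t) K l = Sample (map_pmf (\<lambda>ch.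
     ask_all (trial_keys L) (trial_query n l ch) (\<lambda>ans. let D = decode L n l ch ans
       in forest_alg L n t (K \<union> (\<lambda>(v, u). {v, u}) ` D) (relabel l D)))
     (trial_choices L n))"

text \<open>What \<open>decode\<close> recovers, written in terms of the graph itself; it serves the
  analysis only, as the algorithm cannot see \<open>w\<close>.\<close>

definition found_edges ::
    "nat \<Rightarrow> (nat set \<Rightarrow> real) \<Rightarrow> (nat \<Rightarrow> nat) \<Rightarrow> trial_choice \<Rightarrow> (nat \<times> nat) set" where
  "found_edges n w l = (\<lambda>((b, c), R). {(v, u). v < n \<and> bit (l v) b \<noteq> c \<and>
    {x \<in> sampled n l ((b, c), R). {v, x} \<in> edges n w} = {u}})"

text \<open>Decoding is exact, so a trial is a random step on the state \<open>(K, l)\<close>, and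
  later arguments need not mention the answers.\<close>

lemma run_forest_alg_Suc:
  assumes "weighted_graph n w" "0 < L" "n \<le> 2 ^ L"
  shows "run (query_answer (adjacency_mat n w)) (forest_alg L n (Suc t) K l) =
    bind_pmf (trial_choices L n) (\<lambda>ch. let D = found_edges n w l ch in
      map_pmf (\<lambda>(F, vs). (F, map (trial_query n l ch) (trial_keys L) @ vs))
        (run (query_answer (adjacency_mat n w))
          (forest_alg L n t (K \<union> (\<lambda>(v, u). {v, u}) ` D) (relabel l D))))"
proof -
  let ?orc = "query_answer (adjacency_mat n w)"
  let ?next = "\<lambda>D. forest_alg L n t (K \<union> (\<lambda>(v, u). {v, u}) ` D) (relabel l D)"
  have "run ?orc (ask_all (trial_keys L) (trial_query n l ch) (\<lambda>ans. ?next (decode L n l ch ans))) =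
     map_pmf (\<lambda>(F, vs). (F, map (trial_query n l ch) (trial_keys L) @ vs))
       (run ?orc (?next (found_edges n w l ch)))" for ch
  proof -
    obtain b c R where ch: "ch = ((b, c), R)" by (metis surj_pair)
    obtain ans where ans: "\<forall>k \<in> set (trial_keys L). ans k = ?orc (trial_query n l ch k)"
      "run ?orc (ask_all (trial_keys L) (trial_query n l ch) (\<lambda>ans. ?next (decode L n l ch ans))) =
        map_pmf (\<lambda>(F, vs). (F, map (trial_query n l ch) (trial_keys L) @ vs))
        (run ?orc (?next (decode L n l ch ans)))"
      using run_ask_all[of "trial_keys L" ?orc "trial_query n l ch"
        "\<lambda>ans. ?next (decode L n l ch ans)"] by blast
    have "decode L n l ch ans = found_edges n w l ch"
      using decode_trial_query[OF assms, of ans l b c R] ans(1)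
      by (simp add: ch found_edges_def trial_keys)
    then show ?thesis using ans(2) by simp
  qed
  then show ?thesis
    by (simp add: Let_def join_eq_bind_pmf bind_map_pmf)
qed

section \<open>Number and form of the queries\<close>

lemma run_forest_alg_queries:
  assumes "weighted_graph n w" "0 < L" "n \<le> 2 ^ L"
  shows "(F, vs) \<in> set_pmf (run (query_answer (adjacency_mat n w)) (forest_alg L n t K l)) \<Longrightarrow>
    set vs \<subseteq> boolean_vecs n \<and> length vs = t * (2 * L)"
proof (induction t arbitrary: K l vs)
  case (Suc t)
  let ?run = "\<lambda>D. run (query_answer (adjacency_mat n w))
    (forest_alg L n t (K \<union> (\<lambda>(v, u). {v, u}) ` D) (relabel l D))"
  from Suc.prems obtain ch where "(F, vs) \<in>
      (\<lambda>(F, us). (F, map (trial_query n l ch) (trial_keys L) @ us)) `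
        set_pmf (?run (found_edges n w l ch))"
    unfolding run_forest_alg_Suc[OF assms] Let_def set_bind_pmf set_map_pmf by blast
  then obtain us where "(F, us) \<in> set_pmf (?run (found_edges n w l ch))"
    and vs: "vs = map (trial_query n l ch) (trial_keys L) @ us"
    by auto
  then have "set us \<subseteq> boolean_vecs n \<and> length us = t * (2 * L)" using Suc.IH by blast
  then show ?case
    by (auto simp: vs trial_keys trial_query_def set_vec_in_boolean_vecs)
qed simp

section \<open>Expected progress of one trial\<close>

lemma found_edgesD:
  assumes "(v, u) \<in> found_edges n w l ((b, c), R)"
  shows "{v, u} \<in> edges n w" "bit (l v) b \<noteq> c" "bit (l u) b = c"
proof -
  let ?N = "{x \<in> sampled n l ((b, c), R). {v, x} \<in> edges n w}"
  have "u \<in> ?N" "bit (l v) b \<noteq> c" using assms by (auto simp: found_edges_def)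
  then show "{v, u} \<in> edges n w" "bit (l v) b \<noteq> c" "bit (l u) b = c"
    by (auto simp: sampled_def)
qed

lemma unfinished_found_edges:
  "unfinished (edges n w) (relabel l (found_edges n w l ch))
    \<subseteq> unfinished (edges n w) l - (l \<circ> fst) ` found_edges n w l ch"
proof -
  obtain b c R where ch: "ch = ((b, c), R)" by (metis surj_pair)
  show ?thesis
    unfolding ch
    by (rule unfinished_relabel[where blue = "\<lambda>a. bit a b = c"]) (auto dest: found_edgesD)
qed

text \<open>The 16 is 8 times 2: a suitable bit position, bit value and density are drawn with
  probability at least \<open>1 / (2 * L ^ 2)\<close>, and then a single neighbour is sampled with
  probability at least 1/8.\<close>

lemma prob_hook:
  assumes inv: "labelled_partition n (edges n w) K l" and L: "L = Suc (floor_log n)"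
    and a: "a \<in> unfinished (edges n w) l"
  shows "1 / (16 * real L ^ 2) \<le>
    measure_pmf.prob (trial_choices L n) {ch. a \<in> (l \<circ> fst) ` found_edges n w l ch}"
proof -
  obtain x y where xy: "{x, y} \<in> edges n w" "a = l x" "l x \<noteq> l y"
    using a by (auto simp: unfinished_def)
  then have less: "x < n" "y < n" by (auto dest: edges_lessD)
  have "n < 2 ^ L" using floor_log_exp2_gt[of n] by (simp add: L)
  moreover have "l x < n" "l y < n" using inv less by (auto simp: labelled_partition_def)
  ultimately have "l x < 2 ^ L" "l y < 2 ^ L" by auto
  then obtain b where b: "b < L" "bit (l x) b \<noteq> bit (l y) b"
    using nat_bit_eqI xy(3) by blast
  \<comment> \<open>With this \<open>c\<close> the vertex \<open>x\<close> is red and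
    \<open>y\<close> is blue, so the set \<open>M\<close> of blue neighbours of \<open>x\<close> is
    non-empty.\<close>
  define c where "c = bit (l y) b"
  define M where "M = {z. z < n \<and> {x, z} \<in> edges n w \<and> bit (l z) b = c}"
  have M: "M \<subseteq> {..<n}" "y \<in> M" using xy less by (auto simp: M_def c_def)
  then have "card M \<le> n" using card_mono[of "{..<n}" M] by simp
  then have j: "floor_log (card M) < L" using floor_log_le_iff by (simp add: L less_Suc_eq_le)
  have hook: "a \<in> (l \<circ> fst) ` found_edges n w l ((b, c), R)" if "{z \<in> M. R z} = {u}" for R u
  proof -
    have "{z \<in> sampled n l ((b, c), R). {x, z} \<in> edges n w} = {z \<in> M. R z}"
      by (auto simp: sampled_def M_def)
    then have "(x, u) \<in> found_edges n w l ((b, c), R)"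
      using that less b by (auto simp: found_edges_def c_def)
    then show ?thesis using xy(2) by force
  qed
  have "1 / 8 \<le> measure_pmf.prob (sampling n (floor_log (card M))) {R. \<exists>u. {z \<in> M. R z} = {u}}"
    using M by (intro prob_sampling_unique) auto
  also have "\<dots> \<le> measure_pmf.prob (sampling n (floor_log (card M)))
      {R. ((b, c), R) \<in> {ch. a \<in> (l \<circ> fst) ` found_edges n w l ch}}"
    using hook by (intro measure_pmf.finite_measure_mono) auto
  finally have "1 / 8 / (2 * real L ^ 2) \<le> \<dots> / (2 * real L ^ 2)"
    by (rule divide_right_mono) simp
  also have "\<dots> \<le> measure_pmf.prob (trial_choices L n)
      {ch. a \<in> (l \<circ> fst) ` found_edges n w l ch}"
    by (rule prob_trial_choices_ge[OF b(1) j])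
  finally show ?thesis by simp
qed

text \<open>Linearity of expectation over the old unfinished labels, each of which survives only if
  it is not hooked. Dependence between the hooks is harmless.\<close>

lemma expected_unfinished:
  assumes inv: "labelled_partition n (edges n w) K l" and L: "L = Suc (floor_log n)"
  shows "measure_pmf.expectation (trial_choices L n)
      (\<lambda>ch. real (card (unfinished (edges n w) (relabel l (found_edges n w l ch)))))
    \<le> (1 - 1 / (16 * real L ^ 2)) * real (card (unfinished (edges n w) l))"
proof -
  let ?U = "unfinished (edges n w) l" and ?p = "trial_choices L n"
  let ?H = "\<lambda>a. {ch. a \<in> (l \<circ> fst) ` found_edges n w l ch}"
  have fin: "finite ?U" using unfinished_subset[OF inv] finite_subset by blast
  have int: "integrable (measure_pmf ?p) (indicator A :: _ \<Rightarrow> real)" for A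
    by (intro measure_pmf.integrable_const_bound[of _ 1]) auto
  have bound: "real (card (unfinished (edges n w) (relabel l (found_edges n w l ch)))) \<le>
      (\<Sum>a\<in>?U. indicator (- ?H a) ch)" for ch
  proof -
    have "real (card (unfinished (edges n w) (relabel l (found_edges n w l ch)))) \<le>
        real (card (?U - (l \<circ> fst) ` found_edges n w l ch))"
      by (intro of_nat_mono card_mono unfinished_found_edges finite_Diff fin)
    also have "?U - (l \<circ> fst) ` found_edges n w l ch = {a \<in> ?U. ch \<in> - ?H a}"
      by auto
    also have "real (card \<dots>) = (\<Sum>a\<in>?U. indicator (- ?H a) ch)"
      using fin by (simp add: indicator_def sum.If_cases Int_def)
    finally show ?thesis .
  qed
  have "measure_pmf.expectation ?p
      (\<lambda>ch. real (card (unfinished (edges n w) (relabel l (found_edges n w l ch)))))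
    \<le> measure_pmf.expectation ?p (\<lambda>ch. \<Sum>a\<in>?U. indicator (- ?H a) ch)"
  proof (rule integral_mono_AE')
    show "integrable (measure_pmf ?p) (\<lambda>ch. \<Sum>a\<in>?U. indicator (- ?H a) ch :: real)"
      using int by (intro Bochner_Integration.integrable_sum)
    show "AE ch in ?p. 0 \<le> (\<Sum>a\<in>?U. indicator (- ?H a) ch :: real)"
      by (intro AE_I2 sum_nonneg) simp
  qed (intro AE_I2 bound)
  also have "\<dots> = (\<Sum>a\<in>?U. measure_pmf.prob ?p (- ?H a))"
    by (subst Bochner_Integration.integral_sum) (auto intro: int)
  also have "\<dots> = (\<Sum>a\<in>?U. 1 - measure_pmf.prob ?p (?H a))"
    using measure_pmf.prob_compl[of _ ?p] by (simp only: Compl_eq_Diff_UNIV) simp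
  also have "\<dots> \<le> (\<Sum>a\<in>?U. 1 - 1 / (16 * real L ^ 2))"
    by (intro sum_mono diff_left_mono prob_hook[OF inv L])
  finally show ?thesis by (simp add: mult.commute)
qed

section \<open>Failure probability after all trials\<close>

lemma hook_bound_le_1:
  assumes "0 < L"
  shows "1 / (16 * real L ^ 2) \<le> 1"
proof -
  have "1 \<le> real L ^ 2" using assms by (intro one_le_power) simp
  then show ?thesis using assms by (subst divide_le_eq_1_pos) (simp, linarith)
qed

text \<open>A Markov-type bound by induction: condition on the first trial, apply the hypothesis to
  the new state and average with \<open>expected_unfinished\<close>.\<close>

lemma prob_forest_alg_failure:
  assumes w: "weighted_graph n w" and L: "L = Suc (floor_log n)"
  shows "labelled_partition n (edges n w) K l \<Longrightarrow>
    measure_pmf.prob (run (query_answer (adjacency_mat n w)) (forest_alg L n t K l))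
      {(F, vs). \<not> spanning_forest n w F}
    \<le> (1 - 1 / (16 * real L ^ 2)) ^ t * real (card (unfinished (edges n w) l))"
proof (induction t arbitrary: K l)
  case 0
  show ?case
  proof (cases "unfinished (edges n w) l = {}")
    case True
    then show ?thesis using spanning_forest_some_forest[OF 0] by simp
  next
    case False
    moreover have "finite (unfinished (edges n w) l)"
      using unfinished_subset[OF 0] finite_subset by blast
    \<comment> \<open>With no trial left, a count of at least 1 already dominates any
      probability.\<close>
    ultimately have "1 \<le> real (card (unfinished (edges n w) l))"
      by (simp add: Suc_le_eq card_gt_0_iff)
    then show ?thesis
      by (simp only: power_0 mult_1_left) (erule order_trans[OF measure_pmf.prob_le_1])
  qed
next
  case (Suc t)
  let ?orc = "query_answer (adjacency_mat n w)" and ?Q = "1 - 1 / (16 * real L ^ 2)"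
  let ?l = "\<lambda>ch. relabel l (found_edges n w l ch)"
  let ?K = "\<lambda>ch. K \<union> (\<lambda>(v, u). {v, u}) ` found_edges n w l ch"
  let ?U = "\<lambda>ch. real (card (unfinished (edges n w) (?l ch)))"
  have L': "0 < L" "n \<le> 2 ^ L" using floor_log_exp2_gt[of n] by (auto simp: L)
  have Q: "0 \<le> ?Q" using hook_bound_le_1[OF L'(1)] by simp
  have inv: "labelled_partition n (edges n w) (?K ch) (?l ch)" for ch
    using found_edgesD(1) by (intro labelled_partition_relabel[OF Suc.prems]) (metis surj_pair)
  have "?U ch \<le> real n" for ch
    using card_mono[OF _ unfinished_subset[OF inv[of ch]]] by simp
  then have int: "integrable (measure_pmf (trial_choices L n)) ?U"
    by (intro measure_pmf.integrable_const_bound[of _ n]) auto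
  have "measure_pmf.prob (run ?orc (forest_alg L n (Suc t) K l)) {(F, vs). \<not> spanning_forest n w F} =
      measure_pmf.expectation (trial_choices L n) (\<lambda>ch. measure_pmf.prob
        (run ?orc (forest_alg L n t (?K ch) (?l ch))) {(F, vs). \<not> spanning_forest n w F})"
    unfolding run_forest_alg_Suc[OF w L'] prob_bind_pmf Let_def
    by (simp add: vimage_def case_prod_unfold)
  also have "\<dots> \<le> measure_pmf.expectation (trial_choices L n) (\<lambda>ch. ?Q ^ t * ?U ch)"
  proof (rule integral_mono_AE')
    show "AE ch in trial_choices L n. 0 \<le> ?Q ^ t * ?U ch"
      by (intro AE_I2 mult_nonneg_nonneg zero_le_power Q of_nat_0_le_iff)
  qed (auto intro: int AE_I2 Suc.IH[OF inv])
  also have "\<dots> = ?Q ^ t * measure_pmf.expectation (trial_choices L n) ?U"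
    by simp
  also have "\<dots> \<le> ?Q ^ t * (?Q * real (card (unfinished (edges n w) l)))"
    using expected_unfinished[OF Suc.prems L] Q by (intro mult_left_mono) auto
  finally show ?case by (simp add: mult_ac)
qed

section \<open>Choice of the number of trials\<close>

definition trials :: "nat \<Rightarrow> nat" where
  "trials L = 16 * L ^ 2 * (L + 3)"

text \<open>By 1 - x \<le> exp (-x), every \<open>16 * L ^ 2\<close> trials gain a factor e, which
  is at least 2. Of the \<open>L + 3\<close> such blocks, \<open>L\<close> pay for \<open>n\<close>
  and the other 3 leave 1/8.\<close>

lemma failure_bound:
  assumes L: "0 < L" "n \<le> 2 ^ L"
  shows "(1 - 1 / (16 * real L ^ 2)) ^ trials L * real n \<le> 1 / 5"
proof -
  let ?z = "16 * real L ^ 2"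
  have z: "0 < ?z" "1 / ?z \<le> 1" using L hook_bound_le_1[of L] by auto
  have "(1 - 1 / ?z) ^ trials L \<le> exp (- 1 / ?z) ^ trials L"
    using z(2) exp_ge_add_one_self[of "- 1 / ?z"] by (intro power_mono) auto
  also have "\<dots> = exp (- real (L + 3))"
    using z(1) by (simp add: trials_def flip: exp_of_nat_mult)
  also have "\<dots> = exp (-1) ^ (L + 3)"
    by (simp flip: exp_of_nat_mult)
  also have "\<dots> \<le> (1 / 2) ^ (L + 3)"
    using exp_ge_add_one_self[of "1 :: real"]
    by (intro power_mono) (auto simp: exp_minus field_simps)
  finally have "(1 - 1 / ?z) ^ trials L * real n \<le> (1 / 2) ^ (L + 3) * 2 ^ L"
    using of_nat_mono[OF L(2), where ?'a = real] by (intro mult_mono) auto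
  also have "\<dots> = 1 / 8" by (simp add: power_add power_divide)
  finally show ?thesis by simp
qed

lemma trials_bigo:
  "(\<lambda>n. real (trials (Suc (floor_log n)) * (2 * Suc (floor_log n)))) \<in> O(\<lambda>n. ln (real n) ^ 4)"
proof -
  have "(\<lambda>n. real (Suc (floor_log n))) \<in> O(\<lambda>n. ln (real n))"
  \<comment> \<open>For n \<ge> 2, 1 plus the binary logarithm is at most twice that logarithm, and
    2 / ln 2 \<le> 3 since ln 2 \<ge> 2/3; so 4 is ample.\<close>
  proof (rule bigoI[of _ 4])
    show "\<forall>\<^sub>F n in sequentially. norm (real (Suc (floor_log n))) \<le> 4 * norm (ln (real n))"
      using eventually_ge_at_top[of 2]
    proof eventually_elim
      case (elim n)
      have "real (floor_log n) \<le> log 2 (real n)"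
        using elim by (simp add: floor_log_altdef)
      moreover have "1 \<le> log 2 (real n)" using elim by simp
      ultimately have "real (Suc (floor_log n)) \<le> 2 * log 2 (real n)" by simp
      also have "\<dots> = ln (real n) * (2 / ln 2)" by (simp add: log_def)
      also have "\<dots> \<le> ln (real n) * 4"
        using elim ln2_ge_two_thirds by (intro mult_left_mono) (auto simp: field_simps)
      finally show ?case using elim by simp
    qed
  qed
  then have "(\<lambda>n. real (Suc (floor_log n)) ^ 4) \<in> O(\<lambda>n. ln (real n) ^ 4)"
    by (rule landau_o.big_power)
  moreover have "(\<lambda>n. real (trials (Suc (floor_log n)) * (2 * Suc (floor_log n))))
      \<in> O(\<lambda>n. real (Suc (floor_log n)) ^ 4)"
  \<comment> \<open>The constant is 32 times 4, as \<open>k + 3\<close> is at most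
    \<open>4 * k\<close> for k \<ge> 1.\<close>
  proof (rule bigoI[of _ 128], rule always_eventually, rule allI)
    fix n
    define k where "k = Suc (floor_log n)"
    have "real (trials k * (2 * k)) = 32 * (real k ^ 3 * (real k + 3))"
      by (simp add: trials_def power2_eq_square power3_eq_cube algebra_simps)
    also have "\<dots> \<le> 32 * (real k ^ 3 * (4 * real k))"
      by (intro mult_left_mono) (auto simp: k_def)
    also have "\<dots> = 128 * real k ^ 4"
      by (simp add: power4_eq_xxxx power3_eq_cube)
    finally show "norm (real (trials (Suc (floor_log n)) * (2 * Suc (floor_log n)))) \<le>
        128 * norm (real (Suc (floor_log n)) ^ 4)"
      unfolding k_def[symmetric] real_norm_def by simp
  qed
  ultimately show ?thesis using landau_o.big_trans by blast
qed

theorem theorem8: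
  shows "\<exists>(alg :: nat \<Rightarrow> (real vec, real vec, nat set set) query_alg) (q :: nat \<Rightarrow> nat).
    (\<lambda>n. real (q n)) \<in> O(\<lambda>n. ln (real n) ^ 4) \<and>
    (\<forall>n w. weighted_graph n w \<longrightarrow>
      (\<forall>(F, vs) \<in> set_pmf (run (query_answer (adjacency_mat n w)) (alg n)).
         set vs \<subseteq> boolean_vecs n \<and> length vs \<le> q n) \<and>
      measure_pmf.prob (run (query_answer (adjacency_mat n w)) (alg n))
        {(F, vs). spanning_forest n w F} \<ge> 4 / 5)"
proof (intro exI conjI allI impI)
  let ?L = "\<lambda>n. Suc (floor_log n)"
  \<comment> \<open>At the start no edge is known and every vertex is labelled by its own
    number.\<close>
  let ?alg = "\<lambda>n. forest_alg (?L n) n (trials (?L n)) {} id"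
  let ?q = "\<lambda>n. trials (?L n) * (2 * ?L n)"
  show "(\<lambda>n. real (?q n)) \<in> O(\<lambda>n. ln (real n) ^ 4)" by (rule trials_bigo)
  fix n w assume w: "weighted_graph n w"
  let ?run = "run (query_answer (adjacency_mat n w)) (?alg n)"
  have L: "0 < ?L n" "n \<le> 2 ^ ?L n" using floor_log_exp2_ge[of n] by auto
  show "\<forall>(F, vs) \<in> set_pmf ?run. set vs \<subseteq> boolean_vecs n \<and> length vs \<le> ?q n"
    using run_forest_alg_queries[OF w L] by fastforce
  have inv: "labelled_partition n (edges n w) {} id"
    by (auto simp: labelled_partition_def reachable_refl)
  have Q: "0 \<le> 1 - 1 / (16 * real (?L n) ^ 2)" using hook_bound_le_1[OF L(1)] by linarith
  have "measure_pmf.prob ?run {(F, vs). \<not> spanning_forest n w F} \<le>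
      (1 - 1 / (16 * real (?L n) ^ 2)) ^ trials (?L n) * real (card (unfinished (edges n w) id))"
    by (rule prob_forest_alg_failure[OF w refl inv])
  \<comment> \<open>Labels are vertex numbers, so at most \<open>n\<close> of them are
    unfinished.\<close>
  also have "\<dots> \<le> (1 - 1 / (16 * real (?L n) ^ 2)) ^ trials (?L n) * real n"
    using card_mono[OF _ unfinished_subset[OF inv]] Q by (intro mult_left_mono) auto
  also have "\<dots> \<le> 1 / 5" by (rule failure_bound[OF L])
  finally have "measure_pmf.prob ?run {(F, vs). \<not> spanning_forest n w F} \<le> 1 / 5" .
  moreover have "{(F, vs). \<not> spanning_forest n w F} =
      space (measure_pmf ?run) - {(F, vs). spanning_forest n w F}" by auto
  ultimately show "4 / 5 \<le> measure_pmf.prob ?run {(F, vs). spanning_forest n w F}"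
    using measure_pmf.prob_compl[of "{(F, vs). spanning_forest n w F}" ?run] by simp
qed

end
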